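(* Let $m \ge n \ge 1$ be integers and let $A=(a_{ij})$ be a real $m\times n$ matrix with columns $\vec{c}_1,\ldots,\vec{c}_n\in\mathbb{R}^m$. Let $\operatorname{detl} A = \left|\vec{c}_1\wedge\cdots\wedge\vec{c}_n\right|$ be the determinant-like function of $A$. Then $$\operatorname{detl} A = \left(\sum_{1\le i_1<i_2<\cdots<i_n\le m} \left(\det A_{i_1,\ldots,i_n}\right)^{2}\right)^{1/2},$$ where $A_{i_1,\ldots,i_n}$ denotes the $n\times n$ submatrix of $A$ consisting of the rows $i_1,\ldots,i_n$ (in this order), and the sum runs over all $\binom{m}{n}$ strictly increasing $n$-tuples of indices.
   Context: For $m\ge n$ and vectors $\vec{c}_1,\ldots,\vec{c}_n\in\mathbb{R}^m$, the determinant-like function of the matrix with these columns is defined as the unsigned $n$-volume $\operatorname{detl}(\vec{c}_1,\ldots,\vec{c}_n) := \left|\vec{c}_1\wedge\cdots\wedge\vec{c}_n\right|$. Here the wedge product is taken in the exterior power $\bigwedge^n\mathbb{R}^m$, and $|X| = \langle X,X\rangle^{1/2}$ is the norm coming from the inner product on $\bigwedge^n\mathbb{R}^m$ induced by the standard inner product of $\mathbb{R}^m$, i.e. the bilinear extension of $\langle \vec{u}_1\wedge\cdots\wedge\vec{u}_n,\ \vec{v}_1\wedge\cdots\wedge\vec{v}_n\rangle = \det\left(\langle \vec{u}_i,\vec{v}_j\rangle\right)_{1\le i,j\le n}$. *)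

theory Defs
  imports "HOL-Analysis.Analysis" "HOL-Analysis.Finite_Function_Topology"
begin

text \<open>
  The exterior power of \<open>'a\<close> with \<open>CARD('n)\<close> factors: the free real vector space on families
  \<open>u :: 'n \<Rightarrow> 'a\<close> (finitely supported formal combinations), modulo the subspace generated by the
  relations that make the class of \<open>u\<close> multilinear and alternating in \<open>u\<close>.
\<close>

inductive_set wedge_relations :: "(('n::finite \<Rightarrow> 'a::real_vector) \<Rightarrow>\<^sub>0 real) set"
  where
    add: "Poly_Mapping.single (u(i := x + y)) 1
            - (Poly_Mapping.single (u(i := x)) 1 + Poly_Mapping.single (u(i := y)) 1)
          \<in> wedge_relations"
  | scale: "Poly_Mapping.single (u(i := r *\<^sub>R x)) 1 - r *\<^sub>R Poly_Mapping.single (u(i := x)) 1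
          \<in> wedge_relations"
  | alternating: "i \<noteq> j \<Longrightarrow> u i = u j \<Longrightarrow> Poly_Mapping.single u 1 \<in> wedge_relations"

quotient_type (overloaded) ('a, 'n) exterior_power =
    "('n::finite \<Rightarrow> 'a::real_vector) \<Rightarrow>\<^sub>0 real" / "\<lambda>p q. p - q \<in> span wedge_relations"
proof (intro equivpI reflpI sympI transpI)
  fix p q r :: "('n \<Rightarrow> 'a) \<Rightarrow>\<^sub>0 real"
  show "p - p \<in> span wedge_relations"
    by (simp add: span_zero)
  show "q - p \<in> span wedge_relations" if "p - q \<in> span wedge_relations"
    using span_neg[OF that] by simp
  show "p - r \<in> span wedge_relations"
    if "p - q \<in> span wedge_relations" "q - r \<in> span wedge_relations"
    using span_add[OF that] by simp
qed

instantiation exterior_power :: (real_vector, finite) real_vector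
begin

lift_definition zero_exterior_power :: "('a, 'b) exterior_power" is 0 .

lift_definition plus_exterior_power ::
    "('a, 'b) exterior_power \<Rightarrow> ('a, 'b) exterior_power \<Rightarrow> ('a, 'b) exterior_power" is "(+)"
  by (simp add: add_diff_add span_add)

lift_definition minus_exterior_power ::
    "('a, 'b) exterior_power \<Rightarrow> ('a, 'b) exterior_power \<Rightarrow> ('a, 'b) exterior_power" is "(-)"
proof -
  fix p p' q q' :: "('b \<Rightarrow> 'a) \<Rightarrow>\<^sub>0 real"
  assume "p - p' \<in> span wedge_relations" "q - q' \<in> span wedge_relations"
  then have "(p - p') - (q - q') \<in> span wedge_relations" by (rule span_diff)
  then show "p - q - (p' - q') \<in> span wedge_relations" by (simp add: algebra_simps)
qed

lift_definition uminus_exterior_power :: "('a, 'b) exterior_power \<Rightarrow> ('a, 'b) exterior_power"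
  is uminus
  by (simp only: minus_diff_minus span_neg)

lift_definition scaleR_exterior_power ::
    "real \<Rightarrow> ('a, 'b) exterior_power \<Rightarrow> ('a, 'b) exterior_power" is "scaleR"
  by (simp only: scaleR_diff_right[symmetric] span_scale)

instance
  by standard (transfer; simp add: algebra_simps span_zero)+

end

text \<open>\<open>wedge u\<close> is the wedge product of the vectors \<open>u j\<close>, with \<open>j\<close> ranging over \<open>'n\<close>.\<close>

lift_definition wedge :: "('n::finite \<Rightarrow> 'a::real_vector) \<Rightarrow> ('a, 'n) exterior_power"
  is "\<lambda>u. Poly_Mapping.single u 1" .

lemma wedge_add: "wedge (u(i := x + y)) = wedge (u(i := x)) + wedge (u(i := y))"
  by transfer (blast intro: span_base wedge_relations.add)

lemma wedge_scaleR: "wedge (u(i := r *\<^sub>R x)) = r *\<^sub>R wedge (u(i := x))"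
  by transfer (blast intro: span_base wedge_relations.scale)

lemma wedge_alternating: "i \<noteq> j \<Longrightarrow> u i = u j \<Longrightarrow> wedge u = 0"
  by transfer (simp add: span_base wedge_relations.alternating)

definition gram_det :: "('n::finite \<Rightarrow> 'a::real_inner) \<Rightarrow> ('n \<Rightarrow> 'a) \<Rightarrow> real" where
  "gram_det u v = det (\<chi> i j. u i \<bullet> v j)"

text \<open>The bilinear extension of \<open>gram_det\<close> to formal combinations; it descends to the quotient.\<close>

definition gram_form ::
    "(('n::finite \<Rightarrow> 'a::real_inner) \<Rightarrow>\<^sub>0 real) \<Rightarrow> (('n \<Rightarrow> 'a) \<Rightarrow>\<^sub>0 real) \<Rightarrow> real" where
  "gram_form p q =
    (\<Sum>u\<in>Poly_Mapping.keys p. \<Sum>v\<in>Poly_Mapping.keys q.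
       Poly_Mapping.lookup p u * Poly_Mapping.lookup q v * gram_det u v)"

lemma gram_det_commute: "gram_det u v = gram_det v u"
proof -
  have "gram_det u v = det (transpose (\<chi> i j. u i \<bullet> v j))"
    by (simp add: gram_det_def)
  also have "transpose (\<chi> i j. u i \<bullet> v j) = (\<chi> i j. v i \<bullet> u j)"
    by (simp add: transpose_def inner_commute)
  finally show ?thesis by (simp add: gram_det_def)
qed

lemma gram_form_commute: "gram_form p q = gram_form q p"
  unfolding gram_form_def
  by (subst sum.swap) (simp add: gram_det_commute mult.commute mult.left_commute)

lemma gram_form_superset:
  assumes "finite S" "Poly_Mapping.keys p \<subseteq> S"
  shows "gram_form p q = (\<Sum>u\<in>S. Poly_Mapping.lookup p u *
           (\<Sum>v\<in>Poly_Mapping.keys q. Poly_Mapping.lookup q v * gram_det u v))"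
  unfolding gram_form_def sum_distrib_left mult.assoc
  using assms by (intro sum.mono_neutral_left) (auto simp: in_keys_iff)

lemma linear_gram_form: "linear (\<lambda>p. gram_form p q)"
proof (rule linearI)
  fix p p' :: "('a \<Rightarrow> 'b) \<Rightarrow>\<^sub>0 real" and r :: real
  let ?S = "Poly_Mapping.keys p \<union> Poly_Mapping.keys p'"
  have sub: "Poly_Mapping.keys (p + p') \<subseteq> ?S" by (rule Poly_Mapping.keys_add)
  show "gram_form (p + p') q = gram_form p q + gram_form p' q"
    by (simp add: gram_form_superset[of ?S] sub lookup_add distrib_right sum.distrib)
  have lookup: "Poly_Mapping.lookup (r *\<^sub>R p) u = r * Poly_Mapping.lookup p u" for u
    using finite_subset[of "{u. r * Poly_Mapping.lookup p u \<noteq> 0}" "Poly_Mapping.keys p"]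
    by (auto simp: scaleR_poly_mapping_def in_keys_iff)
  have "Poly_Mapping.keys (r *\<^sub>R p) \<subseteq> Poly_Mapping.keys p"
    by (auto simp: in_keys_iff lookup)
  then show "gram_form (r *\<^sub>R p) q = r *\<^sub>R gram_form p q"
    by (simp add: gram_form_superset[of "Poly_Mapping.keys p"] lookup sum_distrib_left mult.assoc)
qed

lemma gram_form_single:
  "gram_form (Poly_Mapping.single u 1) q =
     (\<Sum>v\<in>Poly_Mapping.keys q. Poly_Mapping.lookup q v * gram_det u v)"
  by (simp add: gram_form_def)

lemma gram_det_fun_upd:
  "gram_det (u(i := z)) v = det (\<chi> k. if k = i then (\<chi> j. z \<bullet> v j) else (\<chi> j. u k \<bullet> v j))"
  unfolding gram_det_def by (rule arg_cong[where f = det]) (simp add: vec_eq_iff)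

lemma gram_det_add: "gram_det (u(i := x + y)) v = gram_det (u(i := x)) v + gram_det (u(i := y)) v"
proof -
  have row: "(\<chi> j. (x + y) \<bullet> v j) = (\<chi> j. x \<bullet> v j) + (\<chi> j. y \<bullet> v j)"
    by (simp add: vec_eq_iff inner_add_left)
  show ?thesis unfolding gram_det_fun_upd row by (rule det_row_add)
qed

lemma gram_det_scaleR: "gram_det (u(i := r *\<^sub>R x)) v = r * gram_det (u(i := x)) v"
proof -
  have row: "(\<chi> j. (r *\<^sub>R x) \<bullet> v j) = r *s (\<chi> j. x \<bullet> v j)"
    by (simp add: vec_eq_iff)
  show ?thesis unfolding gram_det_fun_upd row by (rule det_row_mul)
qed

lemma gram_det_alternating: "i \<noteq> j \<Longrightarrow> u i = u j \<Longrightarrow> gram_det u v = 0"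
  unfolding gram_det_def by (rule det_identical_rows[of i j]) (auto simp: row_def)

lemma gram_form_span_wedge_relations:
  assumes "p \<in> span wedge_relations"
  shows "gram_form p q = 0"
proof (rule linear_eq_0_on_span[OF linear_gram_form _ assms])
  fix p :: "('a \<Rightarrow> 'b) \<Rightarrow>\<^sub>0 real"
  assume "p \<in> wedge_relations"
  then show "gram_form p q = 0"
    by cases
      (simp_all add: linear_diff[OF linear_gram_form] linear_add[OF linear_gram_form]
        linear_scale[OF linear_gram_form] gram_form_single gram_det_add gram_det_scaleR
        gram_det_alternating distrib_left sum.distrib sum_distrib_left mult.left_commute)
qed

lift_definition exterior_inner ::
    "('a::real_inner, 'n::finite) exterior_power \<Rightarrow> ('a, 'n) exterior_power \<Rightarrow> real" is gram_form
proof -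
  fix p p' q q' :: "('n \<Rightarrow> 'a) \<Rightarrow>\<^sub>0 real"
  assume p: "p - p' \<in> span wedge_relations" and q: "q - q' \<in> span wedge_relations"
  have eq: "gram_form a c = gram_form b c" if "a - b \<in> span wedge_relations"
    for a b c :: "('n \<Rightarrow> 'a) \<Rightarrow>\<^sub>0 real"
    using gram_form_span_wedge_relations[OF that, of c]
    by (simp add: linear_diff[OF linear_gram_form])
  show "gram_form p q = gram_form p' q'"
    using eq[OF p, of q] eq[OF q, of p'] by (simp add: gram_form_commute)
qed

lemma exterior_inner_commute: "exterior_inner X Y = exterior_inner Y X"
  by transfer (rule gram_form_commute)

lemma exterior_inner_add_left:
  "exterior_inner (X + Y) Z = exterior_inner X Z + exterior_inner Y Z"
  by transfer (rule linear_add[OF linear_gram_form])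

lemma exterior_inner_scaleR_left: "exterior_inner (r *\<^sub>R X) Y = r * exterior_inner X Y"
  by transfer (simp add: linear_scale[OF linear_gram_form])

lemma exterior_inner_wedge: "exterior_inner (wedge u) (wedge v) = det (\<chi> i j. u i \<bullet> v j)"
  by transfer (simp add: gram_form_single gram_det_def)

definition exterior_norm :: "('a::real_inner, 'n::finite) exterior_power \<Rightarrow> real" where
  "exterior_norm X = sqrt (exterior_inner X X)"

definition detl :: "real ^ 'n ^ 'm \<Rightarrow> real" where
  "detl A = exterior_norm (wedge (\<lambda>j::'n::finite. column j A))"

definition row_submatrix :: "real ^ 'n ^ 'm \<Rightarrow> ('n \<Rightarrow> 'm) \<Rightarrow> real ^ 'n ^ 'n" where
  "row_submatrix A i = (\<chi> k l. A $ i k $ l)"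

end

theory Submission
  imports Defs
begin

text \<open>
  \<open>detl A\<close> is the square root of the Gram determinant of the columns of \<open>A\<close>. Its rows are sums
  of multiples of rows of \<open>A\<close>; by multilinearity it is a sum over all choices of one row of
  \<open>A\<close> for each index, and only injective choices contribute. An injective choice is uniquely a
  permutation followed by a strictly increasing choice, and for a fixed increasing choice the sum
  over the permutations is the Leibniz expansion of the square of the corresponding minor.
\<close>

text \<open>Mapping a strictly increasing function over the sorted list of its domain gives a sorted
  list without repetitions, and such a list is determined by its set of elements, here the common
  range.\<close>

lemma strict_mono_eqI:
  fixes g h :: "'a::{finite,linorder} \<Rightarrow> 'b::linorder"
  assumes g: "strict_mono g" and h: "strict_mono h" and range: "range g = range h"
  shows "g = h"
proof -
  have list: "map k (sorted_list_of_set UNIV) = sorted_list_of_set (range k)"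
    if "strict_mono k" for k :: "'a \<Rightarrow> 'b"
  proof (rule sorted_distinct_set_unique)
    show "sorted (map k (sorted_list_of_set UNIV))"
      using strict_mono_mono[OF that] by (intro sorted_map_mono) (auto intro: mono_on_subset)
    show "distinct (map k (sorted_list_of_set UNIV))"
      using strict_mono_imp_inj_on[OF that] by (auto simp: distinct_map intro: inj_on_subset)
  qed auto
  have "map g (sorted_list_of_set UNIV) = map h (sorted_list_of_set UNIV)"
    by (simp only: list[OF g] list[OF h] range)
  then show ?thesis
    by (auto simp: fun_eq_iff)
qed

text \<open>The witness sends \<open>x\<close> to the entry of the sorted list of \<open>S\<close>
  at position \<open>?rank x\<close>. Counting the elements strictly below \<open>x\<close> makes
  positions start at 0, as \<open>!\<close> requires.\<close>

lemma strict_mono_with_range_exists: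
  fixes S :: "'b::linorder set"
  assumes fin: "finite S" and card: "card S = CARD('a)"
  obtains g :: "'a::{finite,linorder} \<Rightarrow> 'b" where "strict_mono g" "range g = S"
proof
  let ?rank = "\<lambda>x::'a. card {y. y < x}"
  let ?g = "\<lambda>x. sorted_list_of_set S ! ?rank x"
  have rank_less: "?rank x < CARD('a)" for x
    by (rule psubset_card_mono) auto
  have rank_mono: "?rank x < ?rank y" if "x < y" for x y
    using that by (intro psubset_card_mono) auto
  show mono: "strict_mono ?g"
  proof (rule strict_monoI)
    fix x y :: 'a assume "x < y"
    then show "?g x < ?g y"
      using sorted_wrt_nth_less[OF strict_sorted_list_of_set[of S] rank_mono, of x y]
        rank_less[of y] card by simp
  qed
  \<comment> \<open>Inclusion suffices: \<open>?g\<close> is injective, so its range has as many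
    elements as \<open>S\<close>.\<close>
  have "range ?g \<subseteq> S"
    using fin card rank_less nth_mem[of _ "sorted_list_of_set S"] by auto
  then show "range ?g = S"
    using card_image[OF strict_mono_imp_inj_on[OF mono]] card
    by (intro card_subset_eq[OF fin]) auto
qed

text \<open>Since \<open>p\<close> is surjective, \<open>g \<circ> p\<close> has the range of
  \<open>g\<close>, which determines \<open>g\<close>; injectivity of \<open>g\<close> then
  determines \<open>p\<close>. Conversely, for injective \<open>f\<close>, take the increasing
  \<open>g\<close> with the range of \<open>f\<close> and let \<open>p\<close> be \<open>f\<close>
  followed by \<open>inv g\<close>.\<close>

lemma bij_betw_strict_mono_comp_permutation:
  "bij_betw (\<lambda>(g, p). g \<circ> p)
     ({g :: 'a::{finite,linorder} \<Rightarrow> 'b::linorder. strict_mono g} \<times> {p. p permutes UNIV})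
     {f. inj f}"
proof (rule bij_betwI')
  fix s t :: "('a \<Rightarrow> 'b) \<times> ('a \<Rightarrow> 'a)"
  assume s: "s \<in> {g. strict_mono g} \<times> {p. p permutes UNIV}"
    and t: "t \<in> {g. strict_mono g} \<times> {p. p permutes UNIV}"
  obtain g p h q where st: "s = (g, p)" "t = (h, q)"
    by (metis surj_pair)
  have mono: "strict_mono g" "strict_mono h" and surj: "surj p" "surj q"
    using s t st permutes_surj by blast+
  have "s = t" if eq: "g \<circ> p = h \<circ> q"
  proof -
    have "range g = range h"
      using arg_cong[OF eq, of range] surj by (simp only: image_comp[symmetric])
    then have "g = h"
      using mono by (intro strict_mono_eqI)
    moreover from this have "p = q"
      using eq inj_eq[OF strict_mono_imp_inj_on[OF mono(1)]] by (simp add: fun_eq_iff)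
    ultimately show ?thesis
      by (simp add: st)
  qed
  then show "((case s of (g, p) \<Rightarrow> g \<circ> p) = (case t of (g, p) \<Rightarrow> g \<circ> p)) = (s = t)"
    by (auto simp: st)
next
  fix s :: "('a \<Rightarrow> 'b) \<times> ('a \<Rightarrow> 'a)"
  assume "s \<in> {g. strict_mono g} \<times> {p. p permutes UNIV}"
  then show "(case s of (g, p) \<Rightarrow> g \<circ> p) \<in> {f. inj f}"
    by (auto simp: inj_compose[OF strict_mono_imp_inj_on permutes_inj])
next
  fix f :: "'a \<Rightarrow> 'b"
  assume "f \<in> {f. inj f}"
  then have f: "inj f" by simp
  obtain g :: "'a \<Rightarrow> 'b" where g: "strict_mono g" "range g = range f"
    using strict_mono_with_range_exists[of "range f"] card_image[OF f] by auto
  have inv: "g (inv g (f x)) = f x" for x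
    using g(2) by (intro f_inv_into_f) simp
  \<comment> \<open>Composing this map with \<open>g\<close> gives back the injective
    \<open>f\<close>. On a finite type an injective self-map is a permutation.\<close>
  have "inj (\<lambda>x. inv g (f x))"
    by (rule inj_on_imageI2[of g]) (simp only: comp_def inv f)
  then have "(\<lambda>x. inv g (f x)) permutes UNIV"
    by (intro bij_imp_permutes) (simp_all add: bij_betw_def finite_UNIV_inj_surj)
  then show "\<exists>s\<in>{g. strict_mono g} \<times> {p. p permutes UNIV}. f = (case s of (g, p) \<Rightarrow> g \<circ> p)"
    using g(1) inv by (intro bexI[of _ "(g, \<lambda>x. inv g (f x))"]) (auto simp: fun_eq_iff)
qed

text \<open>In the Leibniz formula each product of sums expands into a sum over the functions
  \<open>f\<close> that choose one summand per row. Exchanging this sum with the one over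
  permutations leaves a determinant for each \<open>f\<close>.\<close>

lemma det_linear_combination_rows:
  fixes c :: "'n::finite \<Rightarrow> 'm::finite \<Rightarrow> 'a::comm_ring_1"
  shows "det (\<chi> i. \<Sum>k\<in>UNIV. c i k *s w k) =
    (\<Sum>f\<in>UNIV. (\<Prod>i\<in>UNIV. c i (f i)) * det (\<chi> i. w (f i)))"
proof -
  have "det (\<chi> i. \<Sum>k\<in>UNIV. c i k *s w k) =
      (\<Sum>p | p permutes UNIV. \<Sum>f\<in>UNIV.
        of_int (sign p) * (\<Prod>i\<in>UNIV. c i (f i) * w (f i) $ p i))"
    by (simp add: det_def prod_sum_PiE sum_distrib_left)
  also have "\<dots> = (\<Sum>f\<in>UNIV. (\<Prod>i\<in>UNIV. c i (f i)) * det (\<chi> i. w (f i)))"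
    by (subst sum.swap) (simp add: det_def prod.distrib sum_distrib_left mult_ac)
  finally show ?thesis .
qed

lemma det_row_submatrix_not_inj:
  assumes "\<not> inj f"
  shows "det (row_submatrix A f) = 0"
proof -
  obtain i j where "i \<noteq> j" "f i = f j"
    using assms by (auto simp: inj_on_def)
  then show ?thesis
    by (intro det_identical_rows[of i j]) (auto simp: row_def row_submatrix_def)
qed

lemma det_row_submatrix_permute:
  assumes "p permutes UNIV"
  shows "det (row_submatrix A (g \<circ> p)) = of_int (sign p) * det (row_submatrix A g)"
  using det_permute_rows[OF assms, of "row_submatrix A g"] by (simp add: row_submatrix_def)

text \<open>Expanding the transpose puts the permutation on the row choice, so that the product has
  the shape it takes in the main sum for the choice \<open>g \<circ> p\<close>.\<close>

lemma det_row_submatrix_leibniz: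
  "det (row_submatrix A g) =
     (\<Sum>p | p permutes UNIV. of_int (sign p) * (\<Prod>i\<in>UNIV. A $ g (p i) $ i))"
  by (subst det_transpose[symmetric]) (simp add: det_def transpose_def row_submatrix_def)

theorem theorem2p1:
  fixes A :: "real ^ 'n::{finite,linorder} ^ 'm::{finite,linorder}"
  assumes "CARD('n) \<le> CARD('m)"
  shows "detl A = sqrt (\<Sum>i | strict_mono (i :: 'n \<Rightarrow> 'm). (det (row_submatrix A i))\<^sup>2)"
proof -
  let ?term = "\<lambda>f :: 'n \<Rightarrow> 'm. (\<Prod>i\<in>UNIV. A $ f i $ i) * det (row_submatrix A f)"
  \<comment> \<open>Row \<open>i\<close> of the Gram matrix combines the rows of \<open>A\<close>
    with the entries of column \<open>i\<close> as coefficients.\<close>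
  have "(\<chi> i j. column i A \<bullet> column j A) = (\<chi> i. \<Sum>k\<in>UNIV. A $ k $ i *s row k A)"
    by (simp add: vec_eq_iff inner_vec_def column_def row_def)
  then have "det (\<chi> i j. column i A \<bullet> column j A) = (\<Sum>f\<in>UNIV. ?term f)"
    by (simp add: det_linear_combination_rows row_submatrix_def row_def)
  also have "\<dots> = (\<Sum>f | inj f. ?term f)"
    by (rule sum.mono_neutral_right) (auto simp: det_row_submatrix_not_inj)
  also have "\<dots> = (\<Sum>(g, p)\<in>{g. strict_mono g} \<times> {p. p permutes UNIV}. ?term (g \<circ> p))"
    by (subst sum.reindex_bij_betw[OF bij_betw_strict_mono_comp_permutation, symmetric])
      (simp add: case_prod_unfold)
  also have "\<dots> = (\<Sum>g | strict_mono g. \<Sum>p | p permutes UNIV. ?term (g \<circ> p))"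
    by (rule sum.cartesian_product[symmetric])
  also have "\<dots> = (\<Sum>g | strict_mono g. (det (row_submatrix A g))\<^sup>2)"
  proof (rule sum.cong[OF refl])
    fix g :: "'n \<Rightarrow> 'm"
    \<comment> \<open>Reordering the rows by \<open>p\<close> changes the minor only by
      \<open>sign p\<close>, so the minor of \<open>g\<close> factors out; the remaining sum is its
      own Leibniz expansion.\<close>
    have "(\<Sum>p | p permutes UNIV. ?term (g \<circ> p)) =
        (\<Sum>p | p permutes UNIV. of_int (sign p) * (\<Prod>i\<in>UNIV. A $ g (p i) $ i)) *
          det (row_submatrix A g)"
      unfolding sum_distrib_right
      by (rule sum.cong) (simp_all add: det_row_submatrix_permute)
    then show "(\<Sum>p | p permutes UNIV. ?term (g \<circ> p)) = (det (row_submatrix A g))\<^sup>2"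
      by (simp add: det_row_submatrix_leibniz[symmetric] power2_eq_square)
  qed
  finally show ?thesis
    by (simp add: detl_def exterior_norm_def exterior_inner_wedge)
qed

end
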